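(* Let $c:\mathbb{R}^d\times\mathbb{R}^d\to\mathbb{R}_+$ satisfy: (a) $c$ is continuous (and bounded below); (b) for each fixed $y$, $x\mapsto c(x,y)$ is differentiable at every $x$; (c) for every compact $K\subset\mathbb{R}^d$ the functions $x\mapsto c(x,y)$, $y\in K$, are locally Lipschitz with (on each compact set of $x$'s) a common Lipschitz constant valid for all $y\in K$. Let $\rho$ and $\mu$ be probability measures on $\mathbb{R}^d$ such that (i) $\operatorname{Supp}\rho$ is Lipschitz-path connected, (ii) $\operatorname{Supp}\mu$ is bounded. Then optimisers of the dual problem $$\max\left\{\int\phi\,\mathrm{d}\rho+\int\psi\,\mathrm{d}\mu\ :\ \phi\in L^1(\rho),\ \psi\in L^1(\mu),\ \phi(x)+\psi(y)\le c(x,y)\ \forall x,y\right\}$$ are unique up to a constant: if $(\phi_0,\psi_0)$ and $(\phi_1,\psi_1)$ are optimal, there is $\lambda\in\mathbb{R}$ with $\phi_0=\phi_1+\lambda$ $\rho$-a.e. and $\psi_0=\psi_1-\lambda$ $\mu$-a.e.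
   Context: A set $\Omega\subset\mathbb{R}^d$ is Lipschitz-path connected if for any $x_0,x_1\in\Omega$ there is a finite-length curve (without loss of generality Lipschitz, parametrised with constant speed) $\omega:[0,1]\to\Omega$ with $\omega(0)=x_0$, $\omega(1)=x_1$. Standing assumption: there exist $a\in L^1(\rho)$, $b\in L^1(\mu)$ with $c(x,y)\le a(x)+b(y)$ pointwise (so that the primal problem $\min_{\gamma\in\Pi(\rho,\mu)}\int c\,\mathrm{d}\gamma$ is finite, the dual problem has optimisers, and the two values are equal). In the dual constraint, $x$ and $y$ range over sets $\mathcal{X},\mathcal{Y}\subset\mathbb{R}^d$ containing $\operatorname{Supp}\rho$ and $\operatorname{Supp}\mu$ respectively. *)

theory Defs
  imports "HOL-Probability.Probability"
begin

definition measure_support :: "'a::topological_space measure \<Rightarrow> 'a set" where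
  "measure_support M = {x. \<forall>U. open U \<and> x \<in> U \<longrightarrow> emeasure M U > 0}"

text \<open>Finite length of a curve parametrised on \<open>{0..1}\<close>: the lengths of all inscribed polygons
  \<open>\<omega> (t 0), \<dots>, \<omega> (t n)\<close> have a common bound.\<close>

definition finite_length :: "(real \<Rightarrow> 'a::metric_space) \<Rightarrow> bool" where
  "finite_length \<omega> \<longleftrightarrow>
     (\<exists>B. \<forall>n t. mono_on {..n} t \<and> t ` {..n} \<subseteq> {0..1::real} \<longrightarrow>
        (\<Sum>i<n. dist (\<omega> (t i)) (\<omega> (t (Suc i)))) \<le> B)"

text \<open>The connecting curves are only required to be continuous and of finite length. Reparametrising
  proportionally to arc length makes such a curve Lipschitz with constant speed.\<close>

definition Lipschitz_path_connected :: "'a::metric_space set \<Rightarrow> bool" where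
  "Lipschitz_path_connected \<Omega> \<longleftrightarrow>
     (\<forall>x0\<in>\<Omega>. \<forall>x1\<in>\<Omega>. \<exists>\<omega>. path \<omega> \<and> finite_length \<omega> \<and> path_image \<omega> \<subseteq> \<Omega> \<and>
        pathstart \<omega> = x0 \<and> pathfinish \<omega> = x1)"

text \<open>The potentials are total real functions, but the pointwise constraint is imposed on
  \<open>X \<times> Y\<close> only, so their values outside \<open>X\<close> and \<open>Y\<close> are irrelevant as soon as these
  sets contain the (closed) supports.\<close>

definition dual_feasible ::
  "'a set \<Rightarrow> 'a set \<Rightarrow> ('a \<Rightarrow> 'a \<Rightarrow> real) \<Rightarrow> 'a measure \<Rightarrow> 'a measure \<Rightarrow>
   ('a \<Rightarrow> real) \<Rightarrow> ('a \<Rightarrow> real) \<Rightarrow> bool" where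
  "dual_feasible X Y c \<rho> \<mu> \<phi> \<psi> \<longleftrightarrow>
     integrable \<rho> \<phi> \<and> integrable \<mu> \<psi> \<and> (\<forall>x\<in>X. \<forall>y\<in>Y. \<phi> x + \<psi> y \<le> c x y)"

definition dual_value ::
  "'a measure \<Rightarrow> 'a measure \<Rightarrow> ('a \<Rightarrow> real) \<Rightarrow> ('a \<Rightarrow> real) \<Rightarrow> real" where
  "dual_value \<rho> \<mu> \<phi> \<psi> = (\<integral>x. \<phi> x \<partial>\<rho>) + (\<integral>y. \<psi> y \<partial>\<mu>)"

definition dual_optimal ::
  "'a set \<Rightarrow> 'a set \<Rightarrow> ('a \<Rightarrow> 'a \<Rightarrow> real) \<Rightarrow> 'a measure \<Rightarrow> 'a measure \<Rightarrow>
   ('a \<Rightarrow> real) \<Rightarrow> ('a \<Rightarrow> real) \<Rightarrow> bool" where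
  "dual_optimal X Y c \<rho> \<mu> \<phi> \<psi> \<longleftrightarrow>
     dual_feasible X Y c \<rho> \<mu> \<phi> \<psi> \<and>
     (\<forall>\<phi>' \<psi>'. dual_feasible X Y c \<rho> \<mu> \<phi>' \<psi>' \<longrightarrow>
        dual_value \<rho> \<mu> \<phi>' \<psi>' \<le> dual_value \<rho> \<mu> \<phi> \<psi>)"

end

theory Submission
  imports Defs
begin

text \<open>No primal optimiser is needed. Optimality passes to the supports, each \<open>\<phi>\<close> may be replaced by the
  \<open>c\<close>-transform of its \<open>\<psi>\<close>, and the average of two optimal pairs is again optimal. Contact in the
  averaged pair forces contact in both, so at each \<open>x\<close> in the support of \<open>\<rho>\<close> some function
  \<open>\<lambda>x. c x y\<close>, up to a constant, touches \<open>\<phi>0\<close> and \<open>\<phi>1\<close> from above at \<open>x\<close>. Along a rectifiable curve, a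
  function touched from above by differentiable functions follows them on the right of all but
  countably many times, in the weak sense of Dini derivatives; hence \<open>\<phi>0 - \<phi>1\<close> is monotone in
  both directions along the curve, without any almost everywhere differentiability.\<close>

section \<open>Increments along a rectifiable curve\<close>

text \<open>Send each \<open>t\<close> to a point of a countable dense set close to
  \<open>(t, q t)\<close>. This map cannot be injective on an uncountable set, and two times sharing
  a dense point are close in both coordinates.\<close>

lemma uncountable_close_pair:
  fixes q :: "real \<Rightarrow> 'b::{metric_space, second_countable_topology}"
  assumes "uncountable A" "0 < d" "0 < e"
  obtains s t where "s \<in> A" "t \<in> A" "s < t" "t - s < d" "dist (q s) (q t) < e"
proof -
  define r where "r = min d e / 2"
  have "0 < r" using assms by (simp add: r_def)
  obtain D :: "(real \<times> 'b) set" where D: "countable D"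
    and dense: "\<And>U. open U \<Longrightarrow> U \<noteq> {} \<Longrightarrow> \<exists>z\<in>D. z \<in> U"
    using countable_dense_setE by blast
  have "\<exists>z\<in>D. dist (t, q t) z < r" for t
    using dense[of "ball (t, q t) r"] \<open>0 < r\<close> by force
  then obtain h where h: "\<And>t. h t \<in> D" "\<And>t. dist (t, q t) (h t) < r"
    by metis
  have "\<not> inj_on h A"
    using D h(1) assms(1) countable_subset[of "h ` A" D] countable_image_inj_on by blast
  then obtain s t where st: "s \<in> A" "t \<in> A" "s < t" "h s = h t"
    by (metis inj_on_def linorder_neqE_linordered_idom)
  have "dist (s, q s) (t, q t) < r + r"
    using dist_triangle_less_add[of "(s, q s)" "h s" r "(t, q t)" r] h(2)[of s] h(2)[of t] st(4)
    by (simp add: dist_commute)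
  moreover have "dist s t \<le> dist (s, q s) (t, q t)" "dist (q s) (q t) \<le> dist (s, q s) (t, q t)"
    using dist_fst_le[of "(s, q s)" "(t, q t)"] dist_snd_le[of "(s, q s)" "(t, q t)"] by simp_all
  ultimately show thesis
    using that[of s t] st by (simp add: r_def dist_real_def min_def split: if_splits)
qed

text \<open>A one-sided Denjoy-type statement: \<open>f\<close> is touched from above at each \<open>t\<close> by \<open>H t\<close>, and the
  set of \<open>t\<close> where it leaves \<open>H t\<close> on the right with positive slope is countable, because two nearby
  such points with almost equal gradients \<open>p\<close> would force both \<open>f s - f t\<close> and \<open>f t - f s\<close> to be
  too small.\<close>

lemma countable_right_detachment:
  fixes f W :: "real \<Rightarrow> real" and \<omega> p :: "real \<Rightarrow> 'b::euclidean_space"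
  assumes "0 < e"
    and W: "\<And>s t. s \<in> I \<Longrightarrow> t \<in> I \<Longrightarrow> s \<le> t \<Longrightarrow> dist (\<omega> s) (\<omega> t) \<le> W t - W s"
    and touch: "\<And>s t. s \<in> I \<Longrightarrow> t \<in> I \<Longrightarrow> f s - f t \<le> H t s"
    and grad: "\<And>t e. t \<in> I \<Longrightarrow> 0 < e \<Longrightarrow> \<exists>d>0. \<forall>s\<in>I. \<bar>s - t\<bar> < d \<longrightarrow>
      \<bar>H t s - p t \<bullet> (\<omega> s - \<omega> t)\<bar> \<le> e * dist (\<omega> s) (\<omega> t)"
  shows "countable {t \<in> I. \<exists>d>0. \<forall>s\<in>I. t < s \<and> s < t + d \<longrightarrow> f s - f t < H t s - e * (W s - W t)}"
    (is "countable ?N")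
proof (rule ccontr)
  assume "uncountable ?N"
  \<comment> \<open>Makes both radii uniform: countably many sets \<open>P n\<close> cover the
    exceptional set, so one of them is uncountable.\<close>
  define P where "P n t \<longleftrightarrow> t \<in> I \<and>
    (\<forall>s\<in>I. t < s \<and> s < t + inverse (real (Suc n)) \<longrightarrow> f s - f t < H t s - e * (W s - W t)) \<and>
    (\<forall>s\<in>I. \<bar>s - t\<bar> < inverse (real (Suc n)) \<longrightarrow>
      \<bar>H t s - p t \<bullet> (\<omega> s - \<omega> t)\<bar> \<le> (e / 3) * dist (\<omega> s) (\<omega> t))" for n t
  have "?N \<subseteq> (\<Union>n. Collect (P n))"
  proof
    fix t assume t: "t \<in> ?N"
    then obtain d where d: "0 < d"
      "\<forall>s\<in>I. t < s \<and> s < t + d \<longrightarrow> f s - f t < H t s - e * (W s - W t)" by blast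
    obtain d' where d': "0 < d'" "\<forall>s\<in>I. \<bar>s - t\<bar> < d' \<longrightarrow>
      \<bar>H t s - p t \<bullet> (\<omega> s - \<omega> t)\<bar> \<le> (e / 3) * dist (\<omega> s) (\<omega> t)"
      using grad[of t "e / 3"] t \<open>0 < e\<close> by auto
    obtain n where "inverse (real (Suc n)) < min d d'"
      using reals_Archimedean[of "min d d'"] d(1) d'(1) by auto
    then have "P n t"
      unfolding P_def using t d(2) d'(2) by (smt (verit) mem_Collect_eq)
    then show "t \<in> (\<Union>n. Collect (P n))" by blast
  qed
  then obtain n where n: "uncountable (Collect (P n))"
    using \<open>uncountable ?N\<close> by (meson countable_UN countable_subset uncountable_def countableI_type)
  obtain t s where st: "P n t" "P n s" "t < s" "s - t < inverse (real (Suc n))"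
    "dist (p t) (p s) < e / 3"
    using uncountable_close_pair[OF n, of "inverse (real (Suc n))" "e / 3" p] \<open>0 < e\<close> by auto
  define \<Delta> where "\<Delta> = dist (\<omega> s) (\<omega> t)"
  have I: "s \<in> I" "t \<in> I" using st by (auto simp: P_def)
  \<comment> \<open>With \<open>- H s t \<le> f s - f t\<close>, this gives
    \<open>e * (W s - W t) < H t s + H s t\<close>. The right side is at most three errors
    \<open>e / 3 * \<Delta>\<close>, two from differentiation and one from the gradient gap, while
    \<open>\<Delta> \<le> W s - W t\<close>.\<close>
  have 1: "f s - f t < H t s - e * (W s - W t)"
    using st I by (simp add: P_def)
  have 2: "f t - f s \<le> H s t" using touch I by blast
  have 3: "\<bar>H t s - p t \<bullet> (\<omega> s - \<omega> t)\<bar> \<le> (e / 3) * \<Delta>" "\<bar>H s t - p s \<bullet> (\<omega> t - \<omega> s)\<bar> \<le> (e / 3) * \<Delta>"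
    using st I by (auto simp: P_def \<Delta>_def dist_commute abs_minus_commute)
  have "(p t - p s) \<bullet> (\<omega> s - \<omega> t) \<le> dist (p t) (p s) * \<Delta>"
    unfolding \<Delta>_def dist_norm by (rule norm_cauchy_schwarz)
  also have "\<dots> \<le> e / 3 * \<Delta>"
    using st(5) by (intro mult_right_mono) (auto simp: \<Delta>_def)
  finally have 4: "p t \<bullet> (\<omega> s - \<omega> t) + p s \<bullet> (\<omega> t - \<omega> s) \<le> e / 3 * \<Delta>"
    by (simp add: inner_diff_left inner_diff_right)
  have 5: "e * \<Delta> \<le> e * (W s - W t)"
    using W[OF I(2,1)] st(3) \<open>0 < e\<close> by (simp add: \<Delta>_def dist_commute)
  show False using 1 2 3 4 5 by linarith
qed

text \<open>The values of \<open>G\<close> on the exceptional set \<open>N\<close> are countable, so if \<open>G b < G a\<close>, some level between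
  them is avoided by \<open>N\<close>; the last time at which \<open>G\<close> is above this level is a contradiction. Since \<open>W\<close>
  only jumps upwards, its continuity is not needed.\<close>

lemma le_if_right_increase:
  fixes g W :: "real \<Rightarrow> real"
  assumes "a \<le> b" and g: "continuous_on {a..b} g" and W: "mono_on {a..b} W" and N: "countable N"
    and incr: "\<And>t d. a \<le> t \<Longrightarrow> t < b \<Longrightarrow> t \<notin> N \<Longrightarrow> 0 < d \<Longrightarrow>
      \<exists>s\<in>{a..b}. t < s \<and> s < t + d \<and> g t + W t \<le> g s + W s"
  shows "g a + W a \<le> g b + W b"
proof (rule ccontr)
  define G where "G t = g t + W t" for t
  assume "\<not> ?thesis"
  then have "G b < G a" by (simp add: G_def)
  then have "uncountable ({G b<..<G a} - G ` N)"
    using N by (intro uncountable_minus_countable) (auto simp: uncountable_open_interval)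
  then obtain y where y: "G b < y" "y < G a" "y \<notin> G ` N"
    by (metis DiffE countable_empty equals0I greaterThanLessThan_iff)
  define T where "T = {t \<in> {a..b}. y \<le> G t}"
  define u where "u = Sup T"
  have aT: "a \<in> T" using y \<open>a \<le> b\<close> by (simp add: T_def)
  have bdd: "bdd_above T" by (rule bdd_aboveI[of _ b]) (simp add: T_def)
  have u: "a \<le> u" "u \<le> b"
    using aT bdd unfolding u_def by (auto simp: T_def intro!: cSup_upper cSup_least)
  have above: "G s < y" if "u < s" "s \<le> b" for s
    using that u cSup_upper[OF _ bdd, of s] by (force simp: u_def T_def)
  have near: "\<exists>d>0. \<forall>s\<in>{a..b}. \<bar>s - u\<bar> < d \<longrightarrow> \<bar>g s - g u\<bar> < e" if "0 < e" for e
    using g u that unfolding continuous_on_iff dist_real_def by auto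
  \<comment> \<open>Points of \<open>T\<close> approach \<open>u\<close> from the left, where
    \<open>W s \<le> W u\<close>, so the level \<open>y\<close> survives in the limit.\<close>
  have lower: "y \<le> G u"
  proof (rule ccontr)
    assume "\<not> y \<le> G u"
    then obtain d where d: "0 < d" "\<forall>s\<in>{a..b}. \<bar>s - u\<bar> < d \<longrightarrow> \<bar>g s - g u\<bar> < y - G u"
      using near[of "y - G u"] by auto
    obtain s where s: "s \<in> T" "u - d < s"
      using less_cSupE[of "u - d" T] d(1) aT by (auto simp: u_def)
    then have "s \<le> u" using cSup_upper[OF _ bdd] by (simp add: u_def)
    then have "W s \<le> W u" using mono_onD[OF W] s u by (auto simp: T_def)
    moreover have "\<bar>g s - g u\<bar> < y - G u" using d s \<open>s \<le> u\<close> by (auto simp: T_def)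
    ultimately show False using s(1) by (auto simp: G_def T_def)
  qed
  have "u < b" using lower y u by (cases "u = b") auto
  \<comment> \<open>Otherwise continuity of \<open>g\<close> and growth of \<open>W\<close> would
    keep \<open>G\<close> above \<open>y\<close> slightly to the right of \<open>u\<close>.\<close>
  have "G u \<le> y"
  proof (rule ccontr)
    assume "\<not> G u \<le> y"
    then obtain d where d: "0 < d" "\<forall>s\<in>{a..b}. \<bar>s - u\<bar> < d \<longrightarrow> \<bar>g s - g u\<bar> < G u - y"
      using near[of "G u - y"] by auto
    define s where "s = min b (u + d / 2)"
    have s: "u < s" "s \<le> b" "\<bar>s - u\<bar> < d" using d \<open>u < b\<close> by (auto simp: s_def)
    then have "W u \<le> W s" using mono_onD[OF W] u by auto
    moreover have "\<bar>g s - g u\<bar> < G u - y" using d s u by auto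
    ultimately show False using above[OF s(1,2)] by (auto simp: G_def)
  qed
  with lower have "G u = y" by simp
  with y have "u \<notin> N" by auto
  from incr[OF u(1) \<open>u < b\<close> this, of 1] above \<open>G u = y\<close> show False
    by (force simp: G_def)
qed

text \<open>Take for \<open>V t\<close> the supremum of the polygon lengths up to time
  \<open>t\<close>. Prolonging a polygon that ends before \<open>s\<close> to \<open>s\<close> and
  then to \<open>t\<close> adds at least the chord between these two times.\<close>

lemma finite_length_variation:
  assumes "finite_length \<omega>"
  obtains V where "\<And>s t. 0 \<le> s \<Longrightarrow> s \<le> t \<Longrightarrow> t \<le> 1 \<Longrightarrow> dist (\<omega> s) (\<omega> t) \<le> V t - V s"
proof -
  define A where "A t = {\<Sum>i<n. dist (\<omega> (u i)) (\<omega> (u (Suc i))) | n u. mono_on {..n} u \<and> u ` {..n} \<subseteq> {0..t}}"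
    for t :: real
  define V where "V t = Sup (A t)" for t
  have bdd: "bdd_above (A t)" if "t \<le> 1" for t
  proof -
    obtain B where B: "\<And>n u. mono_on {..n} u \<Longrightarrow> u ` {..n} \<subseteq> {0..1} \<Longrightarrow>
      (\<Sum>i<n. dist (\<omega> (u i)) (\<omega> (u (Suc i)))) \<le> B"
      using assms unfolding finite_length_def by metis
    have "{0..t} \<subseteq> {0..1}" using that by auto
    then show ?thesis
      by (intro bdd_aboveI[of _ B]) (auto simp: A_def intro!: B)
  qed
  have "V s + dist (\<omega> s) (\<omega> t) \<le> V t" if st: "0 \<le> s" "s \<le> t" "t \<le> 1" for s t
  proof -
    have "z \<le> V t - dist (\<omega> s) (\<omega> t)" if "z \<in> A s" for z
    proof -
      from that obtain n u where z: "z = (\<Sum>i<n. dist (\<omega> (u i)) (\<omega> (u (Suc i))))"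
        and mono: "mono_on {..n} u" and range: "u ` {..n} \<subseteq> {0..s}"
        by (auto simp: A_def)
      \<comment> \<open>The indices \<open>Suc n\<close> and \<open>Suc (Suc n)\<close> append
        \<open>s\<close> and \<open>t\<close>. The edge from \<open>u n\<close> to \<open>s\<close>
        is later bounded below by zero.\<close>
      define v where "v i = (if i \<le> n then u i else if i = Suc n then s else t)" for i
      have "mono_on {..Suc (Suc n)} v"
        using mono range st unfolding v_def
        by (intro mono_onI) (force simp: mono_on_def image_subset_iff)
      moreover have "v ` {..Suc (Suc n)} \<subseteq> {0..t}"
        using range st by (force simp: v_def image_subset_iff)
      ultimately have "(\<Sum>i<Suc (Suc n). dist (\<omega> (v i)) (\<omega> (v (Suc i)))) \<in> A t"
        unfolding A_def by blast
      then have "(\<Sum>i<Suc (Suc n). dist (\<omega> (v i)) (\<omega> (v (Suc i)))) \<le> V t"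
        unfolding V_def using bdd[OF st(3)] by (rule cSup_upper)
      moreover have "(\<Sum>i<n. dist (\<omega> (v i)) (\<omega> (v (Suc i)))) = z"
        unfolding z by (rule sum.cong) (auto simp: v_def)
      moreover have "v (Suc n) = s" "v (Suc (Suc n)) = t" by (auto simp: v_def)
      ultimately show ?thesis by (simp, smt (verit) zero_le_dist)
    qed
    moreover have "A s \<noteq> {}"
    proof -
      have "(\<Sum>i<0. dist (\<omega> s) (\<omega> s)) \<in> A s"
        unfolding A_def using st by (intro CollectI exI[of _ 0] exI[of _ "\<lambda>_. s"]) (auto simp: mono_on_def)
      then show ?thesis by blast
    qed
    ultimately have "V s \<le> V t - dist (\<omega> s) (\<omega> t)"
      unfolding V_def[of s] by (intro cSup_least) auto
    then show ?thesis by simp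
  qed
  then show thesis using that[of V] by (simp add: algebra_simps)
qed

text \<open>Outside a countable set, \<open>f1\<close> lies below the common upper support function \<open>H t\<close>, and \<open>f0\<close>
  returns arbitrarily close to it on the right of \<open>t\<close>.\<close>

lemma increment_le_if_common_touching:
  fixes f0 f1 :: "real \<Rightarrow> real" and \<omega> p :: "real \<Rightarrow> 'b::euclidean_space"
  assumes "finite_length \<omega>"
    and cont: "continuous_on {0..1} f0" "continuous_on {0..1} f1"
    and touch0: "\<And>s t. s \<in> {0..1} \<Longrightarrow> t \<in> {0..1} \<Longrightarrow> f0 s - f0 t \<le> H t s"
    and touch1: "\<And>s t. s \<in> {0..1} \<Longrightarrow> t \<in> {0..1} \<Longrightarrow> f1 s - f1 t \<le> H t s"
    and grad: "\<And>t e. t \<in> {0..1} \<Longrightarrow> 0 < e \<Longrightarrow> \<exists>d>0. \<forall>s\<in>{0..1}. \<bar>s - t\<bar> < d \<longrightarrow>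
      \<bar>H t s - p t \<bullet> (\<omega> s - \<omega> t)\<bar> \<le> e * dist (\<omega> s) (\<omega> t)"
  shows "f0 0 - f1 0 \<le> f0 1 - f1 1"
proof -
  obtain V where V: "\<And>s t. 0 \<le> s \<Longrightarrow> s \<le> t \<Longrightarrow> t \<le> 1 \<Longrightarrow> dist (\<omega> s) (\<omega> t) \<le> V t - V s"
    using finite_length_variation[OF assms(1)] by blast
  \<comment> \<open>The slope \<open>e\<close> is fixed so that the exceptional set is countable;
    the term \<open>e * V\<close> pays for the gap between \<open>f0\<close> and \<open>H t\<close>.
    Afterwards \<open>e\<close> tends to zero.\<close>
  have "(f0 0 - f1 0) + e * V 0 \<le> (f0 1 - f1 1) + e * V 1" if "0 < e" for e
  proof (rule le_if_right_increase)
    show "mono_on {0..1} (\<lambda>t. e * V t)"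
      using that by (intro mono_onI mult_left_mono)
        (auto intro: diff_ge_0_iff_ge[THEN iffD1] order_trans[OF zero_le_dist V])
    show "countable {t \<in> {0..1}. \<exists>d>0. \<forall>s\<in>{0..1}. t < s \<and> s < t + d \<longrightarrow>
        f0 s - f0 t < H t s - e * (V s - V t)}" (is "countable ?N")
      by (rule countable_right_detachment[OF that V touch0 grad]) auto
    show "\<exists>s\<in>{0..1}. t < s \<and> s < t + d \<and> f0 t - f1 t + e * V t \<le> f0 s - f1 s + e * V s"
      if t: "0 \<le> t" "t < 1" "t \<notin> ?N" "0 < d" for t d
    proof -
      obtain s where s: "s \<in> {0..1}" "t < s" "s < t + d" "\<not> f0 s - f0 t < H t s - e * (V s - V t)"
        using t by auto
      with touch1[of s t] t(1,2) show ?thesis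
        by (intro bexI[of _ s]) (auto simp: algebra_simps)
    qed
  qed (auto intro!: continuous_intros cont)
  then have *: "(f0 0 - f1 0) - (f0 1 - f1 1) \<le> e * (V 1 - V 0)" if "0 < e" for e
    using that by (simp add: algebra_simps)
  have "((\<lambda>e. e * (V 1 - V 0)) \<longlongrightarrow> 0 * (V 1 - V 0)) (at_right 0)"
    by (intro tendsto_intros)
  then have "(f0 0 - f1 0) - (f0 1 - f1 1) \<le> 0 * (V 1 - V 0)"
    by (rule tendsto_lowerbound) (auto intro!: eventually_at_rightI[of 0 1] *)
  then show ?thesis by simp
qed

section \<open>Supports\<close>

lemma closed_measure_support: "closed (measure_support M)"
proof -
  have "- measure_support M = \<Union>{U. open U \<and> emeasure M U = 0}"
    by (auto simp: measure_support_def zero_less_iff_neq_zero)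
  then show ?thesis
    using open_Union[of "{U. open U \<and> emeasure M U = 0}"] by (simp add: closed_def)
qed

text \<open>The complement of the support is a union of open null sets, and by Lindelof countably
  many of them cover it.\<close>

lemma AE_in_measure_support:
  fixes M :: "'b::second_countable_topology measure"
  assumes "sets M = sets borel"
  shows "AE x in M. x \<in> measure_support M"
proof -
  define \<F> where "\<F> = {U. open U \<and> emeasure M U = 0}"
  obtain \<G> where \<G>: "\<G> \<subseteq> \<F>" "countable \<G>" "\<Union>\<G> = \<Union>\<F>"
    using Lindelof[of \<F>] by (auto simp: \<F>_def)
  have "AE x in M. \<forall>U\<in>\<G>. x \<notin> U"
    using \<G>(1,2) assms by (subst AE_ball_countable) (auto simp: \<F>_def null_sets_def intro!: AE_not_in)
  then show ?thesis
  proof (rule AE_mp, intro AE_I2 impI)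
    fix x assume "\<forall>U\<in>\<G>. x \<notin> U"
    then have "x \<notin> \<Union>\<F>" using \<G>(3) by blast
    then show "x \<in> measure_support M"
      by (auto simp: \<F>_def measure_support_def zero_less_iff_neq_zero)
  qed
qed

lemma measure_support_nonempty:
  fixes M :: "'b::second_countable_topology measure"
  assumes "prob_space M" "sets M = sets borel"
  shows "measure_support M \<noteq> {}"
  using AE_in_measure_support[OF assms(2)] prob_space.AE_False[OF assms(1)] by auto

text \<open>The set of disagreement is open by continuity and null by assumption, so it misses the
  support.\<close>

lemma AE_eq_imp_eq_on_support:
  fixes f g :: "'b::topological_space \<Rightarrow> real"
  assumes "sets M = sets borel" "continuous_on UNIV f" "continuous_on UNIV g"
    and "AE x in M. f x = g x" "x \<in> measure_support M"
  shows "f x = g x"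
proof (rule ccontr)
  assume "f x \<noteq> g x"
  have U: "open {x. f x \<noteq> g x}"
    using assms(2,3) by (rule open_Collect_neq)
  have "emeasure M {x. f x \<noteq> g x} = 0"
    using assms(4) U assms(1) by (subst (asm) AE_iff_measurable[OF _ refl]) (auto simp: sets_eq_imp_space_eq[OF assms(1)])
  with U \<open>f x \<noteq> g x\<close> assms(5) show False
    by (auto simp: measure_support_def)
qed

section \<open>Dual potentials on the supports\<close>

text \<open>The infimum is taken in the reals, so it has its intended meaning only for nonempty
  \<open>S\<close> and a family bounded below.\<close>

definition c_transform :: "'a set \<Rightarrow> ('a \<Rightarrow> 'a \<Rightarrow> real) \<Rightarrow> ('a \<Rightarrow> real) \<Rightarrow> 'a \<Rightarrow> real" where
  "c_transform S c \<psi> x = (INF y\<in>S. c x y - \<psi> y)"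

locale bounded_target_transport =
  fixes c :: "'a::euclidean_space \<Rightarrow> 'a \<Rightarrow> real" and \<rho> \<mu> :: "'a measure" and a b :: "'a \<Rightarrow> real"
  assumes c_nonneg: "0 \<le> c x y"
    and c_continuous: "continuous_on UNIV (\<lambda>(x, y). c x y)"
    and c_Lipschitz: "compact K \<Longrightarrow> compact C \<Longrightarrow> \<exists>L. \<forall>y\<in>K. L-lipschitz_on C (\<lambda>x. c x y)"
    and prob: "prob_space \<rho>" "prob_space \<mu>"
    and sets: "sets \<rho> = sets borel" "sets \<mu> = sets borel"
    and a_integrable: "integrable \<rho> a"
    and c_le: "c x y \<le> a x + b y"
    and bounded_support: "bounded (measure_support \<mu>)"
begin

abbreviation "R \<equiv> measure_support \<rho>"
abbreviation "S \<equiv> measure_support \<mu>"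
abbreviation "feasible \<equiv> dual_feasible R S c \<rho> \<mu>"
abbreviation "optimal \<equiv> dual_optimal R S c \<rho> \<mu>"
abbreviation "transf \<equiv> c_transform S c"

lemma compact_S: "compact S"
  using closed_measure_support bounded_support by (simp add: compact_eq_bounded_closed)

lemma nonempty: "R \<noteq> {}" "S \<noteq> {}"
  using measure_support_nonempty prob sets by blast+

lemma AE_supports: "AE x in \<rho>. x \<in> R" "AE y in \<mu>. y \<in> S"
  using AE_in_measure_support sets by blast+

lemma continuous_c: "continuous_on UNIV (c x)" "continuous_on UNIV (\<lambda>x. c x y)"
proof -
  have "continuous_on UNIV ((\<lambda>(x, y). c x y) \<circ> Pair x)"
    by (rule continuous_on_compose[OF _ continuous_on_subset[OF c_continuous]])
      (auto intro!: continuous_intros)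
  then show "continuous_on UNIV (c x)" by (simp add: o_def)
  have "continuous_on UNIV ((\<lambda>(x, y). c x y) \<circ> (\<lambda>x. (x, y)))"
    by (rule continuous_on_compose[OF _ continuous_on_subset[OF c_continuous]])
      (auto intro!: continuous_intros)
  then show "continuous_on UNIV (\<lambda>x. c x y)" by (simp add: o_def)
qed

text \<open>The constraint at a single point \<open>x0\<close> of \<open>R\<close> suffices, since
  \<open>c x0\<close> is bounded on the compact set \<open>S\<close>.\<close>

lemma feasible_bounded:
  assumes "feasible \<phi> \<psi>"
  shows "bdd_above (\<psi> ` S)"
proof -
  obtain x0 where x0: "x0 \<in> R" using nonempty by blast
  have "compact (c x0 ` S)"
    by (rule compact_continuous_image[OF continuous_on_subset[OF continuous_c(1)] compact_S]) auto
  then obtain B where B: "\<And>y. y \<in> S \<Longrightarrow> c x0 y \<le> B"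
    by (meson bounded_imp_bdd_above bdd_above.unfold compact_imp_bounded imageI)
  have "\<psi> y \<le> B - \<phi> x0" if "y \<in> S" for y
    using assms x0 B[OF that] that unfolding dual_feasible_def by fastforce
  then show ?thesis by (rule bdd_aboveI2)
qed

text \<open>Off the supports a competitor must still satisfy the constraint with finite values. Truncating
  \<open>\<phi>'\<close> at height \<open>n\<close> makes this possible because \<open>c\<close> is nonnegative.\<close>

lemma optimal_on_supports:
  assumes opt: "dual_optimal X Y c \<rho> \<mu> \<phi> \<psi>" and "R \<subseteq> X" "S \<subseteq> Y"
  shows "optimal \<phi> \<psi>"
  unfolding dual_optimal_def
proof (intro conjI allI impI)
  show "feasible \<phi> \<psi>"
    using assms unfolding dual_optimal_def dual_feasible_def by blast
  fix \<phi>' \<psi>' assume feas: "feasible \<phi>' \<psi>'"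
  then have int: "integrable \<rho> \<phi>'" "integrable \<mu> \<psi>'"
    and le: "\<And>x y. x \<in> R \<Longrightarrow> y \<in> S \<Longrightarrow> \<phi>' x + \<psi>' y \<le> c x y"
    by (auto simp: dual_feasible_def)
  obtain B where B: "\<And>y. y \<in> S \<Longrightarrow> \<psi>' y \<le> B"
    using feasible_bounded[OF feas] by (auto simp: bdd_above_def)
  define M where "M = max 0 B"
  have M: "0 \<le> M" "\<And>y. y \<in> S \<Longrightarrow> \<psi>' y \<le> M"
    using B by (auto simp: M_def max.coboundedI2)
  have [measurable]: "R \<in> sets \<rho>" "S \<in> sets \<mu>"
    unfolding sets by (intro borel_closed closed_measure_support)+
  have "(\<integral>x. min (\<phi>' x) (real n) \<partial>\<rho>) + (\<integral>y. \<psi>' y \<partial>\<mu>) \<le> dual_value \<rho> \<mu> \<phi> \<psi>" for n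
  proof -
    \<comment> \<open>The values off the supports make every new constraint read
      \<open>f x + h y \<le> 0 \<le> c x y\<close>: \<open>- M\<close> absorbs
      \<open>\<psi>'\<close> on \<open>S\<close>, and \<open>- real n\<close> absorbs the truncated
      \<open>\<phi>'\<close> on \<open>R\<close>.\<close>
    define f where "f x = (if x \<in> R then min (\<phi>' x) (real n) else - M)" for x
    define h where "h y = (if y \<in> S then \<psi>' y else - real n)" for y
    have [measurable]: "\<phi>' \<in> borel_measurable \<rho>" "\<psi>' \<in> borel_measurable \<mu>"
      using int by auto
    have meas: "f \<in> borel_measurable \<rho>" "h \<in> borel_measurable \<mu>"
      unfolding f_def h_def by measurable
    have int_min: "integrable \<rho> (\<lambda>x. min (\<phi>' x) (real n))"
      using int prob_space.finite_measure[OF prob(1)]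
      by (intro integrable_min) (auto intro: finite_measure.integrable_const)
    have ae: "AE x in \<rho>. f x = min (\<phi>' x) (real n)" "AE y in \<mu>. h y = \<psi>' y"
      using AE_supports by (auto simp: f_def h_def)
    have "dual_feasible X Y c \<rho> \<mu> f h"
      unfolding dual_feasible_def
    proof (intro conjI ballI)
      show "integrable \<rho> f"
        using integrable_cong_AE[of f \<rho>, OF meas(1) _ ae(1)] int_min by auto
      show "integrable \<mu> h"
        using integrable_cong_AE[of h \<mu>, OF meas(2) _ ae(2)] int(2) by auto
      fix x y
      show "f x + h y \<le> c x y"
        using le[of x y] M(1) M(2)[of y] c_nonneg[of x y] by (auto simp: f_def h_def)
    qed
    then have "dual_value \<rho> \<mu> f h \<le> dual_value \<rho> \<mu> \<phi> \<psi>"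
      using opt by (simp add: dual_optimal_def)
    moreover have "(\<integral>x. f x \<partial>\<rho>) = (\<integral>x. min (\<phi>' x) (real n) \<partial>\<rho>)"
      using meas ae by (intro integral_cong_AE) auto
    moreover have "(\<integral>x. h x \<partial>\<mu>) = (\<integral>x. \<psi>' x \<partial>\<mu>)"
      using meas ae by (intro integral_cong_AE) auto
    ultimately show ?thesis by (simp add: dual_value_def)
  qed
  moreover have "(\<lambda>n. (\<integral>x. min (\<phi>' x) (real n) \<partial>\<rho>) + (\<integral>y. \<psi>' y \<partial>\<mu>)) \<longlonglongrightarrow> dual_value \<rho> \<mu> \<phi>' \<psi>'"
    unfolding dual_value_def
  proof (intro tendsto_intros integral_dominated_convergence[where w = "\<lambda>x. \<bar>\<phi>' x\<bar>"] AE_I2)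
    fix x
    obtain N where "\<phi>' x \<le> real N" using real_arch_simple by blast
    then have "eventually (\<lambda>n. min (\<phi>' x) (real n) = \<phi>' x) sequentially"
      by (auto simp: eventually_sequentially min_def intro!: exI[of _ N])
    then show "(\<lambda>n. min (\<phi>' x) (real n)) \<longlonglongrightarrow> \<phi>' x" by (rule tendsto_eventually)
  qed (use int in \<open>auto simp: min_def\<close>)
  ultimately show "dual_value \<rho> \<mu> \<phi>' \<psi>' \<le> dual_value \<rho> \<mu> \<phi> \<psi>"
    by (intro LIMSEQ_le_const2) auto
qed

section \<open>The c-transform over a compact support\<close>

context
  fixes \<psi> :: "'a \<Rightarrow> real"
  assumes bdd: "bdd_above (\<psi> ` S)"
begin

lemma bdd_below_c_diff: "bdd_below ((\<lambda>y. c x y - \<psi> y) ` S)"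
proof -
  obtain M where M: "\<And>y. y \<in> S \<Longrightarrow> \<psi> y \<le> M" using bdd by (auto simp: bdd_above_def)
  show ?thesis
  proof (rule bdd_belowI2)
    fix y assume "y \<in> S"
    then show "- M \<le> c x y - \<psi> y" using M[of y] c_nonneg[of x y] by linarith
  qed
qed

lemma c_transform_le: "y \<in> S \<Longrightarrow> transf \<psi> x \<le> c x y - \<psi> y"
  unfolding c_transform_def by (rule cINF_lower[OF bdd_below_c_diff])

lemma le_c_transform: "(\<And>y. y \<in> S \<Longrightarrow> r \<le> c x y - \<psi> y) \<Longrightarrow> r \<le> transf \<psi> x"
  unfolding c_transform_def using nonempty by (intro cINF_greatest)

text \<open>On a unit ball all functions \<open>\<lambda>x. c x y\<close> with \<open>y\<close> in
  \<open>S\<close> share a Lipschitz constant, which passes to their infimum.\<close>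

lemma continuous_c_transform: "continuous_on UNIV (transf \<psi>)"
proof -
  have "continuous_on (ball z 1) (transf \<psi>)" for z
  proof -
    obtain L where L: "\<And>y. y \<in> S \<Longrightarrow> L-lipschitz_on (cball z 1) (\<lambda>x. c x y)"
      using c_Lipschitz[OF compact_S compact_cball[of z 1]] by blast
    have le: "transf \<psi> x - L * dist x x' \<le> transf \<psi> x'" if "x \<in> ball z 1" "x' \<in> ball z 1" for x x'
    proof (rule le_c_transform)
      fix y assume "y \<in> S"
      with lipschitz_onD[OF L[OF this], of x x'] c_transform_le[of y x] that
      show "transf \<psi> x - L * dist x x' \<le> c x' y - \<psi> y"
        by (auto simp: dist_real_def)
    qed
    have "L-lipschitz_on (ball z 1) (transf \<psi>)"
    proof (rule lipschitz_onI)
      show "0 \<le> L" using L nonempty lipschitz_on_nonneg by blast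
      fix x x' assume "x \<in> ball z 1" "x' \<in> ball z 1"
      then show "dist (transf \<psi> x) (transf \<psi> x') \<le> L * dist x x'"
        using le[of x x'] le[of x' x] by (auto simp: dist_real_def abs_le_iff dist_commute)
    qed
    then show ?thesis by (rule lipschitz_on_continuous_on)
  qed
  then have "continuous (at z) (transf \<psi>)" for z
    by (metis centre_in_ball continuous_on_eq_continuous_at open_ball zero_less_one)
  then show ?thesis by (simp add: continuous_at_imp_continuous_on)
qed

end

text \<open>The transform is feasible with \<open>\<psi>\<close> and dominates \<open>\<phi>\<close>
  on \<open>R\<close>. Optimality then forces equal integrals, hence equality almost
  everywhere.\<close>

lemma optimal_c_transform:
  assumes opt: "optimal \<phi> \<psi>"
  shows "optimal (transf \<psi>) \<psi>" "AE x in \<rho>. \<phi> x = transf \<psi> x"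
proof -
  have feas: "feasible \<phi> \<psi>" using opt by (simp add: dual_optimal_def)
  then have int: "integrable \<rho> \<phi>" "integrable \<mu> \<psi>"
    and le: "\<And>x y. x \<in> R \<Longrightarrow> y \<in> S \<Longrightarrow> \<phi> x + \<psi> y \<le> c x y"
    by (auto simp: dual_feasible_def)
  note M = feasible_bounded[OF feas]
  have ge: "\<phi> x \<le> transf \<psi> x" if "x \<in> R" for x
    using le[OF that] by (intro le_c_transform[OF M]) (auto simp: algebra_simps)
  obtain y0 where y0: "y0 \<in> S" using nonempty by blast
  have upper: "transf \<psi> x \<le> a x + (b y0 - \<psi> y0)" for x
    using c_transform_le[OF M y0, of x] c_le[of x y0] by simp
  have meas: "transf \<psi> \<in> borel_measurable \<rho>"
    using borel_measurable_continuous_onI[OF continuous_c_transform[OF M]] sets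
    by (simp cong: measurable_cong_sets)
  \<comment> \<open>On \<open>R\<close> the transform lies between \<open>\<phi>\<close> and
    \<open>a\<close> plus a constant, so the sum of their absolute values dominates it.\<close>
  have "integrable \<rho> (\<lambda>x. \<bar>\<phi> x\<bar> + \<bar>a x + (b y0 - \<psi> y0)\<bar>)"
    using int a_integrable prob_space.finite_measure[OF prob(1)]
    by (intro Bochner_Integration.integrable_add integrable_abs finite_measure.integrable_const)
  then have int_t: "integrable \<rho> (transf \<psi>)"
  proof (rule Bochner_Integration.integrable_bound[OF _ meas])
    show "AE x in \<rho>. norm (transf \<psi> x) \<le> norm (\<bar>\<phi> x\<bar> + \<bar>a x + (b y0 - \<psi> y0)\<bar>)"
      using AE_supports(1)
    proof (rule AE_mp, intro AE_I2 impI)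
      fix x assume "x \<in> R"
      then show "norm (transf \<psi> x) \<le> norm (\<bar>\<phi> x\<bar> + \<bar>a x + (b y0 - \<psi> y0)\<bar>)"
        using ge[of x] upper[of x] unfolding real_norm_def by linarith
    qed
  qed
  have feas_t: "feasible (transf \<psi>) \<psi>"
    unfolding dual_feasible_def
  proof (intro conjI ballI int_t int)
    fix x y assume "x \<in> R" "y \<in> S"
    then show "transf \<psi> x + \<psi> y \<le> c x y" using c_transform_le[OF M, of y x] by linarith
  qed
  then have "dual_value \<rho> \<mu> (transf \<psi>) \<psi> \<le> dual_value \<rho> \<mu> \<phi> \<psi>"
    using opt by (simp add: dual_optimal_def)
  moreover have ae: "AE x in \<rho>. \<phi> x \<le> transf \<psi> x" using AE_supports(1) ge by auto
  then have "(\<integral>x. \<phi> x \<partial>\<rho>) \<le> (\<integral>x. transf \<psi> x \<partial>\<rho>)" by (rule integral_mono_AE[OF int(1) int_t])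
  ultimately have eq: "(\<integral>x. \<phi> x \<partial>\<rho>) = (\<integral>x. transf \<psi> x \<partial>\<rho>)" by (simp add: dual_value_def)
  then show "AE x in \<rho>. \<phi> x = transf \<psi> x"
    by (rule integral_ineq_eq_0_then_AE[OF ae int(1) int_t])
  show "optimal (transf \<psi>) \<psi>"
    using opt feas_t eq by (simp add: dual_optimal_def dual_value_def)
qed

section \<open>Comparison of two optimal pairs\<close>

lemma optimal_value_eq:
  "optimal \<phi>0 \<psi>0 \<Longrightarrow> optimal \<phi>1 \<psi>1 \<Longrightarrow> dual_value \<rho> \<mu> \<phi>0 \<psi>0 = dual_value \<rho> \<mu> \<phi>1 \<psi>1"
  unfolding dual_optimal_def by (meson order_antisym)

text \<open>An almost minimiser \<open>y\<close> for the average of the two optimal pairs almost saturates both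
  constraints at \<open>x\<close>, so a limit point of such \<open>y\<close> yields a common upper support function.\<close>

lemma common_contact:
  assumes opt: "optimal (transf \<psi>0) \<psi>0" "optimal (transf \<psi>1) \<psi>1" and "x \<in> R"
  obtains y where "\<And>x'. transf \<psi>0 x' - transf \<psi>0 x \<le> c x' y - c x y"
    "\<And>x'. transf \<psi>1 x' - transf \<psi>1 x \<le> c x' y - c x y"
proof -
  have feas: "feasible (transf \<psi>0) \<psi>0" "feasible (transf \<psi>1) \<psi>1"
    using opt by (auto simp: dual_optimal_def)
  note M0 = feasible_bounded[OF feas(1)]
  note M1 = feasible_bounded[OF feas(2)]
  define \<phi> where "\<phi> x = (transf \<psi>0 x + transf \<psi>1 x) / 2" for x
  define \<psi> where "\<psi> y = (\<psi>0 y + \<psi>1 y) / 2" for y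
  have int: "integrable \<rho> (transf \<psi>0)" "integrable \<rho> (transf \<psi>1)" "integrable \<mu> \<psi>0" "integrable \<mu> \<psi>1"
    using feas by (auto simp: dual_feasible_def)
  have feas_avg: "feasible \<phi> \<psi>"
    unfolding dual_feasible_def
  proof (intro conjI ballI)
    show "integrable \<rho> \<phi>" "integrable \<mu> \<psi>" unfolding \<phi>_def \<psi>_def using int by auto
    fix x y assume "x \<in> R" "y \<in> S"
    then show "\<phi> x + \<psi> y \<le> c x y"
      using c_transform_le[OF M0, of y x] c_transform_le[OF M1, of y x] by (simp add: \<phi>_def \<psi>_def field_simps)
  qed
  have "dual_value \<rho> \<mu> \<phi> \<psi> = dual_value \<rho> \<mu> (transf \<psi>0) \<psi>0"
    using optimal_value_eq[OF opt] int by (simp add: dual_value_def \<phi>_def[abs_def] \<psi>_def[abs_def] field_simps)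
  then have opt_avg: "optimal \<phi> \<psi>"
    using feas_avg opt(1) by (simp add: dual_optimal_def)
  note M = feasible_bounded[OF feas_avg]
  have "continuous_on UNIV \<phi>"
    unfolding \<phi>_def[abs_def]
    by (intro continuous_intros continuous_c_transform[OF M0] continuous_c_transform[OF M1]) auto
  \<comment> \<open>Optimality of the average gives equality only almost everywhere; continuity of
    both sides extends it to every point of \<open>R\<close>.\<close>
  then have eq: "\<phi> x = transf \<psi> x"
    using AE_eq_imp_eq_on_support[OF sets(1) _ continuous_c_transform[OF M]
        optimal_c_transform(2)[OF opt_avg] \<open>x \<in> R\<close>] by blast
  define e where "e n = inverse (real (Suc n))" for n
  have "\<exists>y\<in>S. c x y - \<psi> y < \<phi> x + e n" for n
  proof -
    have "(INF y\<in>S. c x y - \<psi> y) < \<phi> x + e n"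
      using eq by (simp add: c_transform_def e_def)
    then show ?thesis
      using cINF_less_iff[OF nonempty(2) bdd_below_c_diff[OF M]] by blast
  qed
  then obtain z where z: "\<And>n. z n \<in> S" "\<And>n. c x (z n) - \<psi> (z n) < \<phi> x + e n"
    by metis
  obtain y r where y: "y \<in> S" "strict_mono r" "(z \<circ> r) \<longlonglongrightarrow> y"
    using compact_S z(1) unfolding compact_def by metis
  have c_lim: "(\<lambda>n. c x' (z (r n))) \<longlonglongrightarrow> c x' y" for x'
    using continuous_on_tendsto_compose[OF continuous_c(1) y(3)] by (simp add: o_def)
  have "(\<lambda>n. e (r n)) \<longlonglongrightarrow> 0"
    using LIMSEQ_subseq_LIMSEQ[OF LIMSEQ_inverse_real_of_nat y(2)] by (simp add: o_def e_def)
  then have lim: "(\<lambda>n. c x' (z (r n)) - c x (z (r n)) + 2 * e (r n))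
      \<longlonglongrightarrow> c x' y - c x y + 2 * 0" for x'
    by (intro tendsto_intros c_lim)
  \<comment> \<open>The averaged slack, below \<open>e n\<close>, is the mean of two nonnegative
    slacks, so each is below \<open>2 * e n\<close>. The values of \<open>\<psi>0\<close> and
    \<open>\<psi>1\<close> at \<open>z n\<close> cancel, so only \<open>c\<close> has to pass to the
    limit.\<close>
  have "transf \<psi>0 x' - transf \<psi>0 x \<le> c x' (z n) - c x (z n) + 2 * e n"
    "transf \<psi>1 x' - transf \<psi>1 x \<le> c x' (z n) - c x (z n) + 2 * e n" for x' n
    using z(2)[of n] c_transform_le[OF M0 z(1)[of n], of x] c_transform_le[OF M0 z(1)[of n], of x']
      c_transform_le[OF M1 z(1)[of n], of x] c_transform_le[OF M1 z(1)[of n], of x']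
    unfolding \<phi>_def \<psi>_def by (simp_all add: field_simps)
  then have "transf \<psi>0 x' - transf \<psi>0 x \<le> c x' y - c x y + 2 * 0"
    "transf \<psi>1 x' - transf \<psi>1 x \<le> c x' y - c x y + 2 * 0" for x'
    by (intro LIMSEQ_le_const[OF lim]; blast)+
  then show thesis using that[of y] by simp
qed

text \<open>The pointwise maximum of \<open>\<psi>\<close> and \<open>\<psi>'\<close> is again
  feasible with \<open>\<phi>\<close>, so its integral cannot exceed that of
  \<open>\<psi>\<close>.\<close>

lemma optimal_AE_le:
  assumes "optimal \<phi> \<psi>" "feasible \<phi> \<psi>'"
  shows "AE y in \<mu>. \<psi>' y \<le> \<psi> y"
proof -
  define h where "h y = max (\<psi> y) (\<psi>' y)" for y
  have feas: "feasible \<phi> \<psi>" using assms by (simp add: dual_optimal_def)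
  then have int: "integrable \<mu> \<psi>" "integrable \<mu> h"
    using assms(2) by (auto simp: dual_feasible_def h_def[abs_def])
  have "feasible \<phi> h"
    using feas assms(2) int by (auto simp: dual_feasible_def h_def max_def)
  then have "dual_value \<rho> \<mu> \<phi> h \<le> dual_value \<rho> \<mu> \<phi> \<psi>"
    using assms(1) by (simp add: dual_optimal_def)
  then have "(\<integral>y. h y \<partial>\<mu>) \<le> (\<integral>y. \<psi> y \<partial>\<mu>)"
    by (simp add: dual_value_def)
  moreover have "(\<integral>y. \<psi> y \<partial>\<mu>) \<le> (\<integral>y. h y \<partial>\<mu>)"
    using int by (rule integral_mono) (simp add: h_def)
  ultimately have "AE y in \<mu>. \<psi> y = h y"
    using int by (intro integral_ineq_eq_0_then_AE) (simp_all add: h_def[abs_def])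
  then show ?thesis by (auto simp: h_def max_def split: if_splits)
qed

text \<open>Composition with a connecting curve reduces the claim to one variable: common contact
  points supply \<open>H\<close>, and differentiability of \<open>c\<close> supplies its
  gradients.\<close>

lemma optimal_increment_le:
  assumes diff: "\<And>x y. (\<lambda>x'. c x' y) differentiable (at x)"
    and conn: "Lipschitz_path_connected R"
    and opt: "optimal (transf \<psi>0) \<psi>0" "optimal (transf \<psi>1) \<psi>1"
    and "x0 \<in> R" "x1 \<in> R"
  shows "transf \<psi>0 x0 - transf \<psi>1 x0 \<le> transf \<psi>0 x1 - transf \<psi>1 x1"
proof -
  obtain \<omega> where \<omega>: "path \<omega>" "finite_length \<omega>" "path_image \<omega> \<subseteq> R" "\<omega> 0 = x0" "\<omega> 1 = x1"
    using conn assms(5,6) unfolding Lipschitz_path_connected_def pathstart_def pathfinish_def by blast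
  have in_R: "\<omega> t \<in> R" if "t \<in> {0..1}" for t
    using \<omega>(3) that by (auto simp: path_image_def)
  have feas: "feasible (transf \<psi>0) \<psi>0" "feasible (transf \<psi>1) \<psi>1"
    using opt by (auto simp: dual_optimal_def)
  note M0 = feasible_bounded[OF feas(1)]
  note M1 = feasible_bounded[OF feas(2)]
  have cont_\<omega>: "continuous_on {0..1} \<omega>" using \<omega>(1) by (simp add: path_def)
  have "\<exists>y. (\<forall>x'. transf \<psi>0 x' - transf \<psi>0 (\<omega> t) \<le> c x' y - c (\<omega> t) y) \<and>
      (\<forall>x'. transf \<psi>1 x' - transf \<psi>1 (\<omega> t) \<le> c x' y - c (\<omega> t) y)" if "t \<in> {0..1}" for t
    using common_contact[OF opt in_R[OF that]] by metis
  then obtain y where y: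
    "\<And>t x'. t \<in> {0..1} \<Longrightarrow> transf \<psi>0 x' - transf \<psi>0 (\<omega> t) \<le> c x' (y t) - c (\<omega> t) (y t)"
    "\<And>t x'. t \<in> {0..1} \<Longrightarrow> transf \<psi>1 x' - transf \<psi>1 (\<omega> t) \<le> c x' (y t) - c (\<omega> t) (y t)"
    by metis
  define H where "H t s = c (\<omega> s) (y t) - c (\<omega> t) (y t)" for t s
  define D where "D t = frechet_derivative (\<lambda>x. c x (y t)) (at (\<omega> t))" for t
  have D: "((\<lambda>x. c x (y t)) has_derivative D t) (at (\<omega> t))" for t
    unfolding D_def using diff frechet_derivative_works by blast
  \<comment> \<open>The gradient at \<open>\<omega> t\<close>, that is, the vector representing the
    linear map \<open>D t\<close> through the inner product.\<close>
  define p where "p t = (\<Sum>b\<in>Basis. D t b *\<^sub>R b)" for t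
  have p: "D t v = p t \<bullet> v" for t v
  proof -
    have "linear (D t)" using D has_derivative_linear by blast
    then have "D t (\<Sum>b\<in>Basis. (v \<bullet> b) *\<^sub>R b) = (\<Sum>b\<in>Basis. (v \<bullet> b) * D t b)"
      by (simp add: linear_sum linear_cmul)
    then have "D t v = (\<Sum>b\<in>Basis. (v \<bullet> b) * D t b)"
      by (simp add: euclidean_representation)
    then show ?thesis by (simp add: p_def inner_sum_left inner_commute[of v] mult.commute)
  qed
  have grad: "\<exists>d>0. \<forall>s\<in>{0..1}. \<bar>s - t\<bar> < d \<longrightarrow>
      \<bar>H t s - p t \<bullet> (\<omega> s - \<omega> t)\<bar> \<le> e * dist (\<omega> s) (\<omega> t)" if t: "t \<in> {0..1}" and "0 < e" for t e
  proof -
    obtain d where d: "0 < d" "\<And>x. norm (x - \<omega> t) < d \<Longrightarrow>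
        norm (c x (y t) - c (\<omega> t) (y t) - D t (x - \<omega> t)) \<le> e * norm (x - \<omega> t)"
      using D[of t] \<open>0 < e\<close> unfolding has_derivative_at_alt by blast
    obtain d' where d': "0 < d'" "\<forall>s\<in>{0..1}. \<bar>s - t\<bar> < d' \<longrightarrow> dist (\<omega> s) (\<omega> t) < d"
      using cont_\<omega> t d(1) unfolding continuous_on_iff dist_real_def by metis
    then show ?thesis
      using d(2) by (auto simp: H_def p dist_norm intro!: exI[of _ d'])
  qed
  have "transf \<psi>0 (\<omega> 0) - transf \<psi>1 (\<omega> 0) \<le> transf \<psi>0 (\<omega> 1) - transf \<psi>1 (\<omega> 1)"
  proof (rule increment_le_if_common_touching[OF \<omega>(2) _ _ _ _ grad])
    show "continuous_on {0..1} (\<lambda>t. transf \<psi>0 (\<omega> t))" "continuous_on {0..1} (\<lambda>t. transf \<psi>1 (\<omega> t))"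
      using continuous_on_compose2[OF continuous_c_transform[OF M0] cont_\<omega>]
        continuous_on_compose2[OF continuous_c_transform[OF M1] cont_\<omega>] by auto
  qed (use y in \<open>auto simp: H_def\<close>)
  then show ?thesis by (simp add: \<omega>)
qed

end

theorem theorem5p4:
  fixes c :: "'a::euclidean_space \<Rightarrow> 'a \<Rightarrow> real"
    and \<rho> \<mu> :: "'a measure"
    and X Y :: "'a set"
    and a b \<phi>0 \<psi>0 \<phi>1 \<psi>1 :: "'a \<Rightarrow> real"
  assumes c_nonneg: "\<And>x y. 0 \<le> c x y"
    and c_continuous: "continuous_on UNIV (\<lambda>(x, y). c x y)"
    and c_differentiable: "\<And>x y. (\<lambda>x'. c x' y) differentiable (at x)"
    and c_Lipschitz: "\<And>K C. compact K \<Longrightarrow> compact C \<Longrightarrow>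
          \<exists>L. \<forall>y\<in>K. L-lipschitz_on C (\<lambda>x. c x y)"
    and "prob_space \<rho>" "sets \<rho> = sets borel"
    and "prob_space \<mu>" "sets \<mu> = sets borel"
    and "integrable \<rho> a" "integrable \<mu> b" "\<And>x y. c x y \<le> a x + b y"
    and "measure_support \<rho> \<subseteq> X" "measure_support \<mu> \<subseteq> Y"
    and "Lipschitz_path_connected (measure_support \<rho>)"
    and "bounded (measure_support \<mu>)"
    and "dual_optimal X Y c \<rho> \<mu> \<phi>0 \<psi>0"
    and "dual_optimal X Y c \<rho> \<mu> \<phi>1 \<psi>1"
  shows "\<exists>\<kappa>::real. (AE x in \<rho>. \<phi>0 x = \<phi>1 x + \<kappa>) \<and> (AE y in \<mu>. \<psi>0 y = \<psi>1 y - \<kappa>)"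
proof -
  interpret bounded_target_transport c \<rho> \<mu> a b
    by (intro bounded_target_transport.intro; fact assms)
  have opt: "optimal \<phi>0 \<psi>0" "optimal \<phi>1 \<psi>1"
    using assms(12,13,16,17) optimal_on_supports by blast+
  note T = optimal_c_transform(1)[OF opt(1)] optimal_c_transform(1)[OF opt(2)]
  obtain x0 where x0: "x0 \<in> R" using nonempty by blast
  define \<kappa> where "\<kappa> = transf \<psi>0 x0 - transf \<psi>1 x0"
  \<comment> \<open>The increment inequality holds from \<open>x0\<close> to \<open>x\<close> and
    from \<open>x\<close> to \<open>x0\<close>, which gives equality.\<close>
  have \<kappa>: "transf \<psi>0 x = transf \<psi>1 x + \<kappa>" if "x \<in> R" for x
    using optimal_increment_le[OF c_differentiable assms(14) T x0 that]
      optimal_increment_le[OF c_differentiable assms(14) T that x0] by (simp add: \<kappa>_def)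
  have "AE x in \<rho>. \<phi>0 x = \<phi>1 x + \<kappa>"
    using optimal_c_transform(2)[OF opt(1)] optimal_c_transform(2)[OF opt(2)] AE_supports(1)
    by eventually_elim (simp add: \<kappa>)
  moreover have "AE y in \<mu>. \<psi>0 y = \<psi>1 y - \<kappa>"
  proof -
    have const: "integrable \<mu> (\<lambda>_. \<kappa>)"
      using prob_space.finite_measure[OF prob(2)] by (simp add: finite_measure.integrable_const)
    have feas: "feasible (transf \<psi>0) \<psi>0" "feasible (transf \<psi>1) \<psi>1"
      using T by (auto simp: dual_optimal_def)
    \<comment> \<open>Since the transforms differ by \<open>\<kappa>\<close> on \<open>R\<close>,
      each one is feasible with the shifted second potential of the other pair. Comparing both ways
      bounds \<open>\<psi>0\<close> from both sides.\<close>
    then have "feasible (transf \<psi>0) (\<lambda>y. \<psi>1 y - \<kappa>)" "feasible (transf \<psi>1) (\<lambda>y. \<psi>0 y + \<kappa>)"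
      using const by (auto simp: dual_feasible_def \<kappa> algebra_simps)
    from optimal_AE_le[OF T(1) this(1)] optimal_AE_le[OF T(2) this(2)] show ?thesis
      by eventually_elim simp
  qed
  ultimately show ?thesis by blast
qed

end
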